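(* Let $p,q\ge1$, $n=p+q$, $\mathfrak{g}=\mathfrak{sl}(n)$ over $\mathbb{C}$, and let $\lambda$ be an integral $(p,q)$-dominant weight with $\lambda+\rho=(\lambda_1,\dots,\lambda_n)$. Then the number $m$ of entries in the second column of the Young tableau $P(\lambda)$ is precisely the number of adjacent white-black pairs that can be removed from the line of balls associated to $\lambda$.
   Context: $\mathfrak{h}$ is the Cartan subalgebra of diagonal matrices, $\epsilon_i\in\mathfrak{h}^*$ the $i$-th diagonal coordinate ($\sum_i\epsilon_i=0$), positive roots $\epsilon_i-\epsilon_j$ ($i<j$), $\rho$ the half sum of positive roots. Write $\lambda+\rho=(\lambda_1,\dots,\lambda_n)$ if $\lambda+\rho=\sum_i\lambda_i\epsilon_i$ (defined up to a common additive constant). $\lambda$ is integral iff all $\lambda_i-\lambda_j\in\mathbb{Z}$ (then the $\lambda_i$ may be taken to be integers). $\lambda$ is $(p,q)$-dominant if $\lambda_i-\lambda_j\in\mathbb{Z}_{>0}$ whenever $1\le i<j\le p$ or $p+1\le i<j\le p+q$. $P(\lambda)$ is the tableau obtained from the sequence $(\lambda_1,\dots,\lambda_n)$ by Schensted insertion: start with the empty tableau and insert $\lambda_1,\lambda_2,\dots$ successively. To insert $x$ in a row, replace the leftmost entry of that row strictly bigger than $x$ by $x$ and insert the replaced entry into the next row in the same way; if there is no such entry, add a box containing $x$ at the right end of the row and stop. Each insertion starts with the first row. ($P(\lambda)$ has at most two columns; $m=0$ if there is only one.) Line of balls: take $n$ balls labelled by $\lambda_1,\dots,\lambda_n$; the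 ball of $\lambda_i$ is black if $1\le i\le p$ and white if $p+1\le i\le n$. Arrange them in a line so that labels weakly decrease from left to right, and if $\lambda_i=\lambda_j$ with $i\le p<j$ then the white ball of $\lambda_j$ is to the left of the black ball of $\lambda_i$. An adjacent white-black pair is a pair of adjacent balls with the left ball white and the right ball black. Remove adjacent white-black pairs from the line over and over (balls becoming adjacent after a removal count as adjacent) until no such pair remains; the number counted is the total number of pairs removed, which does not depend on the order of removals. *)

theory Defs
  imports Complex_Main "Jordan_Normal_Form.Matrix"
begin

text \<open>
  Matrix rows, diagonal coordinates and sequence positions are counted from 0, so the
  index $i$ of the usual notation $\lambda_1, \dots, \lambda_n$ is \<open>i - 1\<close> here.
\<close>

section \<open>Weights of the special linear Lie algebra\<close>

definition sl :: "nat \<Rightarrow> complex mat set" where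
  "sl n = {A \<in> carrier_mat n n. (\<Sum>i<n. A $$ (i, i)) = 0}"

definition cartan :: "nat \<Rightarrow> complex mat set" where
  "cartan n = {H \<in> sl n. diagonal_mat H}"

text \<open>
  Elements of the dual of the Cartan subalgebra are represented by functions on all matrices;
  only their values on \<open>cartan n\<close> are constrained and used.
\<close>

definition weight :: "nat \<Rightarrow> (complex mat \<Rightarrow> complex) \<Rightarrow> bool" where
  "weight n lam \<longleftrightarrow>
     (\<forall>H\<in>cartan n. \<forall>K\<in>cartan n. lam (H + K) = lam H + lam K) \<and>
     (\<forall>c. \<forall>H\<in>cartan n. lam (c \<cdot>\<^sub>m H) = c * lam H)"

definition eps :: "nat \<Rightarrow> complex mat \<Rightarrow> complex" where
  "eps i H = H $$ (i, i)"

definition rho :: "nat \<Rightarrow> complex mat \<Rightarrow> complex" where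
  "rho n H = (1 / 2) * (\<Sum>(i, j) \<in> {(i, j). i < j \<and> j < n}. eps i H - eps j H)"

text \<open>\<open>shifted_coords n lam x\<close> says \<open>\<lambda> + \<rho> = (x 0, \<dots>, x (n - 1))\<close>.\<close>

definition shifted_coords :: "nat \<Rightarrow> (complex mat \<Rightarrow> complex) \<Rightarrow> (nat \<Rightarrow> complex) \<Rightarrow> bool" where
  "shifted_coords n lam x \<longleftrightarrow>
     (\<forall>H\<in>cartan n. lam H + rho n H = (\<Sum>i<n. x i * eps i H))"

text \<open>
  The two notions below only involve differences of coordinates, so by
  \<open>shifted_coords_unique\<close> they do not depend on the chosen \<open>x\<close>.
\<close>

definition integral_weight :: "nat \<Rightarrow> (complex mat \<Rightarrow> complex) \<Rightarrow> bool" where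
  "integral_weight n lam \<longleftrightarrow>
     (\<exists>x. shifted_coords n lam x \<and> (\<forall>i<n. \<forall>j<n. x i - x j \<in> \<int>))"

definition pq_dominant :: "nat \<Rightarrow> nat \<Rightarrow> (complex mat \<Rightarrow> complex) \<Rightarrow> bool" where
  "pq_dominant p q lam \<longleftrightarrow>
     (\<exists>x. shifted_coords (p + q) lam x \<and>
          (\<forall>i j. i < j \<and> (j < p \<or> p \<le> i \<and> j < p + q) \<longrightarrow>
             (\<exists>k::nat. k > 0 \<and> x i - x j = of_nat k)))"

lemma shifted_coords_unique:
  assumes x: "shifted_coords n lam x" and y: "shifted_coords n lam y"
    and i: "i < n" and j: "j < n"
  shows "x i - x j = y i - y j"
proof (cases "i = j")
  case False
  define H :: "complex mat" where
    "H = mat n n (\<lambda>(a, b). if a = b then (if a = i then 1 else if a = j then - 1 else 0) else 0)"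
  have split: "(\<Sum>k<n. z k * (if k = i then 1 else if k = j then - 1 else 0)) = z i - z j"
    for z :: "nat \<Rightarrow> complex"
  proof -
    have "(\<Sum>k<n. z k * (if k = i then 1 else if k = j then - 1 else 0)) =
          (\<Sum>k<n. (if k = i then z k else 0) - (if k = j then z k else 0))"
      using False by (intro sum.cong) auto
    then show ?thesis
      using i j by (simp add: sum_subtractf)
  qed
  have eps: "eps k H = (if k = i then 1 else if k = j then - 1 else 0)" if "k < n" for k
    using that by (simp add: H_def eps_def)
  have "(\<Sum>k<n. H $$ (k, k)) = (\<Sum>k<n. 1 * (if k = i then 1 else if k = j then - 1 else 0))"
    using eps by (intro sum.cong) (auto simp: eps_def)
  also have "\<dots> = 0"
    by (subst split) simp
  finally have "H \<in> cartan n"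
    by (auto simp: cartan_def sl_def diagonal_mat_def H_def)
  then have "(\<Sum>k<n. x k * eps k H) = (\<Sum>k<n. y k * eps k H)"
    using x y by (metis shifted_coords_def)
  moreover have "(\<Sum>k<n. z k * eps k H) = z i - z j" for z :: "nat \<Rightarrow> complex"
    using eps split[of z] by simp
  ultimately show ?thesis
    by simp
qed simp

section \<open>Schensted insertion\<close>

text \<open>A tableau is the list of its rows, from top to bottom.\<close>

fun row_insert :: "'a::linorder \<Rightarrow> 'a list \<Rightarrow> 'a list \<times> 'a option" where
  "row_insert x [] = ([x], None)"
| "row_insert x (y # ys) =
     (if x < y then (x # ys, Some y)
      else (case row_insert x ys of (r, b) \<Rightarrow> (y # r, b)))"

fun tableau_insert :: "'a::linorder \<Rightarrow> 'a list list \<Rightarrow> 'a list list" where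
  "tableau_insert x [] = [[x]]"
| "tableau_insert x (r # rs) =
     (case row_insert x r of
        (r', None) \<Rightarrow> r' # rs
      | (r', Some y) \<Rightarrow> r' # tableau_insert y rs)"

definition P_tableau :: "'a::linorder list \<Rightarrow> 'a list list" where
  "P_tableau xs = fold tableau_insert xs []"

definition second_column :: "'a list list \<Rightarrow> 'a list" where
  "second_column T = map (\<lambda>r. r ! 1) (filter (\<lambda>r. length r \<ge> 2) T)"

section \<open>The line of balls\<close>

text \<open>A ball is represented by its position \<open>i\<close> in the sequence; its label is \<open>l i\<close>.\<close>

definition black :: "nat \<Rightarrow> nat \<Rightarrow> bool" where
  "black p i \<longleftrightarrow> i < p"

abbreviation white :: "nat \<Rightarrow> nat \<Rightarrow> bool" where
  "white p i \<equiv> \<not> black p i"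

definition ball_line :: "nat \<Rightarrow> nat \<Rightarrow> (nat \<Rightarrow> int) \<Rightarrow> nat list \<Rightarrow> bool" where
  "ball_line p n l bs \<longleftrightarrow>
     distinct bs \<and> set bs = {..<n} \<and>
     sorted_wrt (\<lambda>b c. l b \<ge> l c \<and> (l b = l c \<longrightarrow> \<not> (black p b \<and> white p c))) bs"

lemma ball_line_exists: "\<exists>bs. ball_line p n l bs"
proof -
  define key where "key b = 2 * (- l b) + (if black p b then 1 else 0)" for b
  have "sorted_wrt (\<lambda>b c. key b \<le> key c) (sort_key key [0..<n])"
    using sorted_sort_key[of key "[0..<n]"] by (simp add: sorted_map)
  then have "sorted_wrt (\<lambda>b c. l b \<ge> l c \<and> (l b = l c \<longrightarrow> \<not> (black p b \<and> white p c)))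
      (sort_key key [0..<n])"
    by (rule sorted_wrt_mono_rel[rotated]) (auto simp: key_def split: if_splits)
  then have "ball_line p n l (sort_key key [0..<n])"
    by (auto simp: ball_line_def atLeast0LessThan)
  then show ?thesis ..
qed

inductive remove_pair :: "nat \<Rightarrow> nat list \<Rightarrow> nat list \<Rightarrow> bool" for p where
  "white p b \<Longrightarrow> black p c \<Longrightarrow> remove_pair p (us @ b # c # vs) (us @ vs)"

definition removable_pairs :: "nat \<Rightarrow> nat list \<Rightarrow> nat \<Rightarrow> bool" where
  "removable_pairs p bs k \<longleftrightarrow>
     (\<exists>cs. (remove_pair p ^^ k) bs cs \<and> \<not> (\<exists>ds. remove_pair p cs ds))"

end

theory Submission
  imports Defs
begin

text \<open>
  Both numbers equal the size of a greedy matching: run through the black labels from the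
  smallest one upwards and match each of them with the smallest unused white label that is at
  least as large. For the line of balls this is the matching of opening and closing brackets,
  read from right to left. For the tableau, peel off the first row: if the word is the
  decreasing sequence of black labels, with minimum \<open>a\<close>, followed by the decreasing sequence
  \<open>us @ ys\<close> of white labels, where \<open>y < a \<le> u\<close> for all \<open>y\<close> in \<open>ys\<close> and \<open>u\<close> in \<open>us\<close>, then the
  first row has length two iff \<open>us\<close> is nonempty, and the entries bumped into the second row
  are the black labels other than \<open>a\<close> followed by \<open>butlast us @ butlast (a # ys)\<close>. This is
  again a concatenation of two decreasing sequences, and compared with \<open>us @ ys\<close> the second
  one has lost the partner of \<open>a\<close>, up to entries too small to be matched.
\<close>

section \<open>Greedy matching of increasing sequences\<close>

fun greedy_matches :: "'a::linorder list \<Rightarrow> 'a list \<Rightarrow> nat" where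
  "greedy_matches [] bs = 0"
| "greedy_matches (a # as) [] = 0"
| "greedy_matches (a # as) (b # bs) =
     (if a \<le> b then Suc (greedy_matches as bs) else greedy_matches (a # as) bs)"

lemma greedy_matches_Nil2 [simp]: "greedy_matches as [] = 0"
  by (cases as) auto

text \<open>Every entry of \<open>cs\<close> lies below the head of \<open>as\<close>, so the
  recursion discards it.\<close>

lemma greedy_matches_skip:
  assumes "\<And>a b. a \<in> set as \<Longrightarrow> b \<in> set cs \<Longrightarrow> b < a"
  shows "greedy_matches as (cs @ bs) = greedy_matches as bs"
proof (cases as)
  case (Cons a as')
  with assms have "\<forall>b\<in>set cs. b < a" by auto
  then show ?thesis unfolding Cons by (induction cs) auto
qed simp

section \<open>The second column of the tableau\<close>

text \<open>With \<open>bumped\<close> this regroups insertion row by row: the word that a row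
  ejects is what feeds the rows below.\<close>

fun bump_row :: "'a::linorder list \<Rightarrow> 'a list \<Rightarrow> 'a list" where
  "bump_row r [] = r"
| "bump_row r (x # xs) = bump_row (fst (row_insert x r)) xs"

fun bumped :: "'a::linorder list \<Rightarrow> 'a list \<Rightarrow> 'a list" where
  "bumped r [] = []"
| "bumped r (x # xs) =
     (case snd (row_insert x r) of
        None \<Rightarrow> bumped (fst (row_insert x r)) xs
      | Some y \<Rightarrow> y # bumped (fst (row_insert x r)) xs)"

lemma fold_tableau_insert_Cons:
  "fold tableau_insert xs (r # rs) = bump_row r xs # fold tableau_insert (bumped r xs) rs"
  by (induction xs arbitrary: r rs) (auto split: prod.splits option.splits)

lemma P_tableau_Cons: "P_tableau (x # xs) = bump_row [x] xs # P_tableau (bumped [x] xs)"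
  by (simp add: P_tableau_def fold_tableau_insert_Cons)

lemma bump_row_append: "bump_row r (xs @ ys) = bump_row (bump_row r xs) ys"
  by (induction xs arbitrary: r) auto

lemma bumped_append: "bumped r (xs @ ys) = bumped r xs @ bumped (bump_row r xs) ys"
  by (induction xs arbitrary: r) (auto split: option.splits)

text \<open>Every letter is below the current head, so it replaces the head and \<open>r\<close> is
  never reached.\<close>

lemma bump_decreasing_head:
  assumes "sorted_wrt (>) (x # ys)"
  shows "bump_row (x # r) ys = last (x # ys) # r \<and> bumped (x # r) ys = butlast (x # ys)"
  using assms by (induction ys arbitrary: x) auto

text \<open>Letters at least \<open>a\<close> pass the first box, and each is below its predecessor
  in the second, so no third box opens.\<close>

lemma bump_decreasing_second:
  assumes "sorted_wrt (>) (y # us)" "\<forall>u\<in>set us. a \<le> u"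
  shows "bump_row [a, y] us = [a, last (y # us)] \<and> bumped [a, y] us = butlast (y # us)"
  using assms by (induction us arbitrary: y) (auto simp: not_less)

lemma bump_singleton_row:
  assumes "sorted_wrt (>) us" "\<forall>u\<in>set us. a \<le> u" "sorted_wrt (>) (a # ys)"
  shows "length (bump_row [a] (us @ ys)) = (if us = [] then 1 else 2)"
    and "bumped [a] (us @ ys) = butlast us @ butlast (a # ys)"
proof -
  have "length (bump_row [a] (us @ ys)) = (if us = [] then 1 else 2) \<and>
        bumped [a] (us @ ys) = butlast us @ butlast (a # ys)"
  proof (cases us)
    case Nil
    then show ?thesis using bump_decreasing_head[OF assms(3)] by simp
  next
    case (Cons y us')
    \<comment> \<open>The first letter of \<open>us\<close> opens the second box. The rest of
      \<open>us\<close> then acts on that box only, and \<open>ys\<close> on the first box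
      only.\<close>
    have "row_insert y [a] = ([a, y], None)"
      using assms(2) Cons by (auto simp: not_less)
    then show ?thesis
      using bump_decreasing_second[of y us' a] bump_decreasing_head[OF assms(3)] assms(1,2) Cons
      by (simp add: bump_row_append bumped_append)
  qed
  then show "length (bump_row [a] (us @ ys)) = (if us = [] then 1 else 2)"
    and "bumped [a] (us @ ys) = butlast us @ butlast (a # ys)" by auto
qed

lemma length_second_column_Cons:
  "length (second_column (r # T)) = (if 2 \<le> length r then 1 else 0) + length (second_column T)"
  by (simp add: second_column_def)

lemma second_column_decreasing:
  assumes "sorted_wrt (>) w"
  shows "length (second_column (P_tableau w)) = 0"
  using assms
proof (induction "length w" arbitrary: w)
  case 0
  then show ?case by (simp add: P_tableau_def second_column_def)
next
  case (Suc k)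
  then obtain x ys where w: "w = x # ys" by (cases w) auto
  \<comment> \<open>The rows below the first form the tableau of \<open>butlast w\<close>, hence the
    induction on length.\<close>
  have "sorted_wrt (>) (butlast w)"
    using Suc.prems by (simp add: butlast_conv_take sorted_wrt_take)
  moreover have "k = length (butlast w)" using Suc.hyps(2) by simp
  ultimately have "length (second_column (P_tableau (butlast w))) = 0"
    using Suc.hyps(1) by blast
  then show ?case
    using bump_decreasing_head[of x ys "[]"] Suc.prems w
    by (simp add: P_tableau_Cons length_second_column_Cons)
qed

text \<open>The prefix \<open>as @ [a]\<close> leaves the row \<open>[a]\<close> and ejects
  \<open>as\<close>; only \<open>bs\<close> can then widen the row.\<close>

lemma P_tableau_decreasing_append:
  assumes "sorted_wrt (>) (as @ [a])"
  shows "P_tableau (as @ a # bs) = bump_row [a] bs # P_tableau (as @ bumped [a] bs)"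
proof (cases as)
  case (Cons x as')
  then have "bump_row [x] (as' @ [a]) = [a]" "bumped [x] (as' @ [a]) = as"
    using bump_decreasing_head[of x "as' @ [a]" "[]"] assms by (simp_all add: butlast_append)
  then show ?thesis
    using Cons bump_row_append[of "[x]" "as' @ [a]" bs] bumped_append[of "[x]" "as' @ [a]" bs]
    by (simp add: P_tableau_Cons)
qed (simp add: P_tableau_Cons)

lemma decreasing_split:
  fixes a :: "'a::linorder"
  assumes "sorted_wrt (>) bs"
  obtains us ys where "bs = us @ ys" "\<forall>u\<in>set us. a \<le> u" "\<forall>y\<in>set ys. y < a"
proof
  show "bs = takeWhile (\<lambda>b. a \<le> b) bs @ dropWhile (\<lambda>b. a \<le> b) bs" by simp
  show "\<forall>u\<in>set (takeWhile (\<lambda>b. a \<le> b) bs). a \<le> u" by (auto dest: set_takeWhileD)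
  show "\<forall>y\<in>set (dropWhile (\<lambda>b. a \<le> b) bs). y < a"
    using assms by (induction bs) (auto simp: not_le)
qed

lemma second_column_eq_greedy_matches:
  assumes "sorted_wrt (<) as" "sorted_wrt (>) bs"
  shows "length (second_column (P_tableau (rev as @ bs))) = greedy_matches as (rev bs)"
  using assms
proof (induction as arbitrary: bs)
  case Nil
  then show ?case by (simp add: second_column_decreasing)
next
  case (Cons a as)
  obtain us ys where bs: "bs = us @ ys" "\<forall>u\<in>set us. a \<le> u" "\<forall>y\<in>set ys. y < a"
    using decreasing_split[OF Cons.prems(2)] .
  have us: "sorted_wrt (>) us" and ys: "sorted_wrt (>) (a # ys)"
    using Cons.prems bs by (auto simp: sorted_wrt_append)
  have rev_as: "sorted_wrt (>) (rev as @ [a])"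
    using Cons.prems(1) by (auto simp: sorted_wrt_append sorted_wrt_rev)
  define cs where "cs = butlast us @ butlast (a # ys)"
  have "sorted_wrt (>) (butlast us)" "sorted_wrt (>) (butlast (a # ys))"
    using us ys by (metis butlast_conv_take sorted_wrt_take)+
  \<comment> \<open>The two pieces are separated by
    \<open>c \<le> a \<le> last us < u\<close>.\<close>
  moreover have "c < u" if u: "u \<in> set (butlast us)" and c: "c \<in> set (butlast (a # ys))" for u c
  proof -
    have ne: "us \<noteq> []" using u by auto
    then have "sorted_wrt (>) (butlast us @ [last us])" using us by simp
    then have "last us < u" using u unfolding sorted_wrt_append by auto
    moreover have "a \<le> last us" using bs(2) ne by simp
    moreover have "c \<le> a" using in_set_butlastD[OF c] bs(3) by auto
    ultimately show ?thesis by order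
  qed
  ultimately have "sorted_wrt (>) cs"
    unfolding cs_def sorted_wrt_append by blast
  then have IH: "length (second_column (P_tableau (rev as @ cs))) = greedy_matches as (rev cs)"
    using Cons.IH Cons.prems(1) by simp
  have "greedy_matches as (rev cs) = greedy_matches as (rev (butlast us))"
  proof -
    have "y < x" if "x \<in> set as" "y \<in> set (rev (butlast (a # ys)))" for x y
    proof -
      have "y \<le> a" using in_set_butlastD[of y "a # ys"] that bs(3) by auto
      moreover have "a < x" using Cons.prems(1) that by simp
      ultimately show ?thesis by order
    qed
    then show ?thesis unfolding cs_def rev_append by (rule greedy_matches_skip)
  qed
  moreover have "greedy_matches (a # as) (rev bs) = greedy_matches (a # as) (rev us)"
  proof -
    have "y < x" if "x \<in> set (a # as)" "y \<in> set (rev ys)" for x y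
      using that bs(3) Cons.prems(1) by fastforce
    then show ?thesis unfolding bs(1) rev_append by (rule greedy_matches_skip)
  qed
  \<comment> \<open>The partner of \<open>a\<close> is \<open>last us\<close>, the head of
    \<open>rev us\<close>.\<close>
  moreover have "greedy_matches (a # as) (rev us) =
      (if us = [] then 0 else 1) + greedy_matches as (rev (butlast us))"
    using bs(2) by (cases us rule: rev_cases) auto
  moreover have "length (second_column (P_tableau (rev as @ a # bs))) =
      (if us = [] then 0 else 1) + length (second_column (P_tableau (rev as @ cs)))"
    using bump_singleton_row[OF us bs(2) ys] bs(1)
    by (simp add: P_tableau_decreasing_append[OF rev_as] length_second_column_Cons cs_def)
  ultimately show ?case using IH by simp
qed

section \<open>Removing pairs of balls\<close>

text \<open>
  The line is read from right to left, so the list argument is the reversed line; \<open>u\<close> is the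
  number of black balls read so far and not yet paired.
\<close>

fun bracket_pairs :: "nat \<Rightarrow> nat \<Rightarrow> nat list \<Rightarrow> nat" where
  "bracket_pairs p u [] = 0"
| "bracket_pairs p u (b # bs) =
     (if black p b then bracket_pairs p (Suc u) bs
      else case u of 0 \<Rightarrow> bracket_pairs p 0 bs | Suc v \<Rightarrow> Suc (bracket_pairs p v bs))"

text \<open>Reading \<open>c\<close> raises the counter and reading \<open>b\<close> lowers it
  again, counting one pair; \<open>vs\<close> is read with the same counter as before.\<close>

lemma bracket_pairs_remove:
  assumes "black p c" "white p b"
  shows "bracket_pairs p u (us @ c # b # vs) = Suc (bracket_pairs p u (us @ vs))"
  using assms by (induction us arbitrary: u) (auto split: nat.splits)

lemma remove_pair_bracket_pairs:
  assumes "remove_pair p bs cs"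
  shows "bracket_pairs p 0 (rev bs) = Suc (bracket_pairs p 0 (rev cs))"
  using assms
proof cases
  case (1 b c us vs)
  then show ?thesis using bracket_pairs_remove[of p c b 0 "rev vs" "rev us"] by simp
qed

lemma remove_pair_append:
  assumes "remove_pair p bs cs"
  shows "remove_pair p (bs @ ds) (cs @ ds)"
  using assms
proof cases
  case (1 b c us vs)
  then show ?thesis using remove_pair.intros[of p b c us "vs @ ds"] by simp
qed

text \<open>A positive \<open>u\<close> stands for unpaired black balls to the right of
  \<open>bs\<close>. A white ball in \<open>bs\<close> may be paired with one of those, which the
  first alternative allows for.\<close>

lemma remove_pair_exists:
  assumes "bracket_pairs p u (rev bs) \<noteq> 0"
  shows "u \<noteq> 0 \<and> (\<exists>b\<in>set bs. white p b) \<or> (\<exists>cs. remove_pair p bs cs)"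
  using assms
proof (induction bs arbitrary: u rule: rev_induct)
  case Nil
  then show ?case by simp
next
  case (snoc b bs)
  show ?case
  proof (cases "black p b")
    case True
    then have "bracket_pairs p (Suc u) (rev bs) \<noteq> 0" using snoc.prems by simp
    then consider "\<exists>c\<in>set bs. white p c" | cs where "remove_pair p bs cs"
      using snoc.IH by blast
    then show ?thesis
    proof cases
      case 1
      then obtain us c vs where split: "bs = us @ c # vs" "white p c" "\<forall>v\<in>set vs. black p v"
        using split_list_last_prop[of bs "\<lambda>c. white p c"] by blast
      \<comment> \<open>The right neighbour \<open>d\<close> of the last white ball \<open>c\<close>
        is black; it is \<open>b\<close> itself if \<open>vs\<close> is empty.\<close>
      obtain d ds where d: "vs @ [b] = d # ds" "black p d"
        using split(3) True by (cases vs) auto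
      have "remove_pair p (us @ c # d # ds) (us @ ds)"
        using split(2) d(2) by (rule remove_pair.intros)
      then show ?thesis using split(1) d(1) by auto
    next
      case 2
      then show ?thesis using remove_pair_append by blast
    qed
  next
    case False
    show ?thesis
    proof (cases u)
      case 0
      then obtain cs where "remove_pair p bs cs"
        using snoc.IH[of 0] snoc.prems False by auto
      then show ?thesis using remove_pair_append by blast
    qed (use False in auto)
  qed
qed

lemma remove_pair_iff: "(\<exists>cs. remove_pair p bs cs) \<longleftrightarrow> bracket_pairs p 0 (rev bs) \<noteq> 0"
  using remove_pair_exists[of p 0 bs] remove_pair_bracket_pairs[of p bs] by auto

lemma relpowp_remove_pair:
  assumes "(remove_pair p ^^ k) bs cs"
  shows "bracket_pairs p 0 (rev bs) = k + bracket_pairs p 0 (rev cs)"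
  using assms
  by (induction k arbitrary: cs) (auto dest!: remove_pair_bracket_pairs)

lemma remove_all_pairs:
  "\<exists>cs. (remove_pair p ^^ bracket_pairs p 0 (rev bs)) bs cs"
proof (induction "bracket_pairs p 0 (rev bs)" arbitrary: bs)
  case 0
  then show ?case by auto
next
  case (Suc k)
  then obtain cs where cs: "remove_pair p bs cs"
    using remove_pair_iff[of p bs] by auto
  then have k: "k = bracket_pairs p 0 (rev cs)"
    using remove_pair_bracket_pairs[OF cs] Suc.hyps(2) by simp
  then obtain ds where "(remove_pair p ^^ k) cs ds" using Suc.hyps(1) by blast
  with cs have "(remove_pair p ^^ Suc k) bs ds" by (rule relpowp_Suc_I2)
  then show ?case unfolding Suc.hyps(2) by blast
qed

text \<open>Each removal lowers the bracket count by exactly one and is possible until the count is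
  zero, so the order of removals does not matter.\<close>

lemma removable_pairs_iff: "removable_pairs p bs k \<longleftrightarrow> k = bracket_pairs p 0 (rev bs)"
proof
  assume "removable_pairs p bs k"
  then show "k = bracket_pairs p 0 (rev bs)"
    unfolding removable_pairs_def remove_pair_iff using relpowp_remove_pair by fastforce
next
  assume k: "k = bracket_pairs p 0 (rev bs)"
  then obtain cs where "(remove_pair p ^^ k) bs cs" using remove_all_pairs by blast
  moreover from relpowp_remove_pair[OF this] have "bracket_pairs p 0 (rev cs) = 0"
    using k by simp
  ultimately show "removable_pairs p bs k"
    unfolding removable_pairs_def remove_pair_iff by blast
qed

text \<open>\<open>pend\<close> holds the labels of black balls read but not yet paired. Brackets
  pair the latest of them, the greedy matching the earliest; only their number matters, since all
  are at most every unread label.\<close>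

lemma bracket_pairs_eq_greedy_matches:
  assumes "sorted_wrt (\<lambda>c b. l c \<le> l b \<and> (l b = l c \<longrightarrow> \<not> (black p b \<and> white p c))) bs"
    and "\<And>a b. a \<in> set pend \<Longrightarrow> b \<in> set bs \<Longrightarrow> a \<le> l b"
  shows "bracket_pairs p (length pend) bs =
    greedy_matches (pend @ map l (filter (black p) bs)) (map l (filter (\<lambda>b. white p b) bs))"
  using assms
proof (induction bs arbitrary: pend)
  case Nil
  then show ?case by simp
next
  case (Cons c bs)
  show ?case
  proof (cases "black p c")
    case True
    have "bracket_pairs p (length (pend @ [l c])) bs =
      greedy_matches ((pend @ [l c]) @ map l (filter (black p) bs))
        (map l (filter (\<lambda>b. white p b) bs))"
      using Cons.prems by (intro Cons.IH) auto
    then show ?thesis using True by simp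
  next
    case False
    show ?thesis
    proof (cases pend)
      case Nil
      \<comment> \<open>No black ball is pending, and the tie rule puts the white label
        \<open>l c\<close> strictly below all unread black labels.\<close>
      have "greedy_matches (map l (filter (black p) bs)) ([l c] @ cs) =
          greedy_matches (map l (filter (black p) bs)) cs" for cs
        by (rule greedy_matches_skip) (use Cons.prems(1) False in \<open>auto simp: order.order_iff_strict\<close>)
      then show ?thesis using Cons.IH[of "[]"] Cons.prems(1) False Nil by simp
    next
      case (Cons x pend')
      then show ?thesis using Cons.IH[of pend'] Cons.prems False by simp
    qed
  qed
qed

section \<open>Labels of each colour and the weight\<close>

lemma map_filter_eq_decreasing:
  fixes l :: "nat \<Rightarrow> 'a::linorder"
  assumes bs: "distinct bs" "sorted_wrt (\<lambda>b c. l c \<le> l b) bs"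
    and js: "sorted_wrt (>) (map l js)" "set (filter P bs) = set js"
  shows "map l (filter P bs) = map l js"
proof -
  have inj: "inj_on l (set js)"
    using js(1) by (metis distinct_map distinct_rev sorted_wrt_rev strict_sorted_iff)
  have "sorted (rev (map l (filter P bs)))"
    using bs(2) by (simp add: sorted_wrt_rev sorted_wrt_map sorted_wrt_filter)
  moreover have "distinct (rev (map l (filter P bs)))"
    using bs(1) inj js(2) by (simp add: distinct_map del: set_filter)
  moreover have "sorted (rev (map l js))" "distinct (rev (map l js))"
    using js(1) by (metis sorted_wrt_rev strict_sorted_iff)+
  moreover have "set (rev (map l (filter P bs))) = set (rev (map l js))"
    using js(2) by (simp del: set_filter)
  ultimately have "rev (map l (filter P bs)) = rev (map l js)"
    by (rule sorted_distinct_set_unique)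
  then show ?thesis by simp
qed

text \<open>The coordinates \<open>x\<close> witnessing dominance may differ from \<open>l\<close>
  by a common constant, which cancels in differences.\<close>

lemma pq_dominant_decreasing:
  assumes "pq_dominant p q lam" "shifted_coords (p + q) lam (\<lambda>i. of_int (l i))"
    and "i < j" "j < p \<or> p \<le> i \<and> j < p + q"
  shows "l j < l i"
proof -
  obtain x k where x: "shifted_coords (p + q) lam x" and k: "(k::nat) > 0" "x i - x j = of_nat k"
    using assms unfolding pq_dominant_def by blast
  have "of_int (l i) - of_int (l j) = x i - x j"
    using shifted_coords_unique[OF assms(2) x, of i j] assms(3,4) by auto
  then have "(of_int (l i - l j) :: complex) = of_int (int k)" using k by simp
  then have "l i - l j = int k" by (simp only: of_int_eq_iff)
  then show ?thesis using k(1) by simp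
qed

theorem theorem1p5:
  fixes p q n m :: nat
    and lam :: "complex mat \<Rightarrow> complex"
    and l :: "nat \<Rightarrow> int"
    and bs :: "nat list"
  assumes "p \<ge> 1" and "q \<ge> 1" and "n = p + q"
    and "weight n lam"
    and "integral_weight n lam"
    and "pq_dominant p q lam"
    and "shifted_coords n lam (\<lambda>i. of_int (l i))"
    and "m = length (second_column (P_tableau (map l [0..<n])))"
    and "ball_line p n l bs"
  shows "\<forall>k. removable_pairs p bs k \<longleftrightarrow> k = m"
proof -
  have dec: "l j < l i" if "i < j" "j < p \<or> p \<le> i \<and> j < p + q" for i j
    using pq_dominant_decreasing assms(3,6,7) that by blast
  have as: "sorted_wrt (>) (map l [0..<p])" and ws: "sorted_wrt (>) (map l [p..<n])"
    using dec assms(3) by (auto simp: sorted_wrt_iff_nth_less)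
  have line: "distinct bs" "set bs = {..<n}"
    "sorted_wrt (\<lambda>b c. l b \<ge> l c \<and> (l b = l c \<longrightarrow> \<not> (black p b \<and> white p c))) bs"
    using assms(9) by (auto simp: ball_line_def)
  from line(3) have weak: "sorted_wrt (\<lambda>b c. l c \<le> l b) bs"
    by (rule sorted_wrt_mono_rel[rotated]) auto
  have blacks: "map l (filter (black p) bs) = map l [0..<p]"
  proof (rule map_filter_eq_decreasing[OF line(1) weak as])
    show "set (filter (black p) bs) = set [0..<p]"
      unfolding set_filter line(2) using assms(3) by (auto simp: black_def)
  qed
  have whites: "map l (filter (\<lambda>b. white p b) bs) = map l [p..<n]"
  proof (rule map_filter_eq_decreasing[OF line(1) weak ws])
    show "set (filter (\<lambda>b. white p b) bs) = set [p..<n]"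
      unfolding set_filter line(2) using assms(3) by (auto simp: black_def)
  qed
  \<comment> \<open>The empty list of pending labels gives the initial counter 0.\<close>
  have "bracket_pairs p (length ([] :: int list)) (rev bs) =
      greedy_matches ([] @ map l (filter (black p) (rev bs)))
        (map l (filter (\<lambda>b. white p b) (rev bs)))"
    by (rule bracket_pairs_eq_greedy_matches) (use line(3) in \<open>simp_all add: sorted_wrt_rev\<close>)
  also have "\<dots> = greedy_matches (rev (map l [0..<p])) (rev (map l [p..<n]))"
    by (simp add: blacks whites flip: rev_filter rev_map)
  also have "\<dots> = length (second_column (P_tableau (rev (rev (map l [0..<p])) @ map l [p..<n])))"
    using as ws by (intro second_column_eq_greedy_matches[symmetric]) (simp_all only: sorted_wrt_rev)
  also have "rev (rev (map l [0..<p])) @ map l [p..<n] = map l [0..<n]"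
    using upt_add_eq_append[of 0 p q] assms(3) by simp
  finally have "bracket_pairs p 0 (rev bs) = m"
    using assms(8) by simp
  then show ?thesis by (simp add: removable_pairs_iff)
qed

end
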